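(* Let $A=v_1\wedge\cdots\wedge v_p$ and $B=w_1\wedge\cdots\wedge w_q$ with $v_i,w_j\in X$. Let $\mathbf A=(\langle v_i,w_j\rangle)$ ($p\times q$), $\mathbf B=(\langle w_i,w_j\rangle)$ ($q\times q$), and let $\mathbf M=\begin{pmatrix}\mathbf 0&\mathbf A\\ \mathbf A^\dagger&\mathbf B\end{pmatrix}$ ($(p+q)\times(p+q)$), where $\mathbf 0$ is the $p\times p$ zero block and $^\dagger$ is the conjugate transpose. Then $$\|A\lrcorner B\|=\sqrt{|\det\mathbf M|}.$$
   Context: $X$ is a finite-dimensional Euclidean (real) or Hermitian (complex) vector space with inner product $\langle\cdot,\cdot\rangle$, conjugate-linear in the left entry in the complex case. $\bigwedge X$ is its exterior algebra, with inner product given by $\langle v_1\wedge\cdots\wedge v_p,w_1\wedge\cdots\wedge w_p\rangle=\det(\langle v_i,w_j\rangle)$, with distinct $\bigwedge^pX$'s orthogonal, $\langle\kappa,\lambda\rangle=\bar\kappa\lambda$ for scalars, extended (sesqui)linearly; $\|M\|=\sqrt{\langle M,M\rangle}$. The left contraction $M\lrcorner N$ of $M,N\in\bigwedge X$ is the unique element with $\langle L,M\lrcorner N\rangle=\langle M\wedge L,N\rangle$ for all $L\in\bigwedge X$. *)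

theory Defs
  imports
    "HOL-Library.Poly_Mapping"
    "HOL-Algebra.QuotRing"
    "Jordan_Normal_Form.Schur_Decomposition"
begin

section \<open>Real and complex scalars\<close>

text \<open>The axiom forces \<open>conjugate x = \<bar>x\<bar>\<^sup>2 / x\<close> for \<open>x \<noteq> 0\<close>, and (by the Gelfand-Mazur theorem) the
  only models are the real numbers with the identity and the complex numbers with conjugation.
  The two instances below are thus the Euclidean and the Hermitian case.\<close>

class rc_scalar = real_normed_field + conjugatable_field +
  fixes real_part :: "'a \<Rightarrow> real"
  assumes conjugate_mult_self: "conjugate x * x = (norm x)\<^sup>2 *\<^sub>R 1"
    and real_part: "(2 * real_part x) *\<^sub>R 1 = x + conjugate x"

instantiation real :: rc_scalar
begin
definition real_part_real :: "real \<Rightarrow> real" where "real_part_real x = x"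
instance by standard (simp_all add: real_part_real_def power2_eq_square)
end

instantiation complex :: rc_scalar
begin
definition real_part_complex :: "complex \<Rightarrow> real" where "real_part_complex = Re"
instance
proof
  fix x :: complex
  show "conjugate x * x = (norm x)\<^sup>2 *\<^sub>R 1"
    by (simp add: complex_norm_square[symmetric] mult.commute[of _ x] scaleR_conv_of_real flip: of_real_power)
  show "(2 * real_part x) *\<^sub>R 1 = x + conjugate x"
    by (simp add: real_part_complex_def complex_eq_iff)
qed
end


section \<open>Finite-dimensional Euclidean and Hermitian spaces\<close>

locale fin_inner_space = vector_space scale
  for scale :: "'k::rc_scalar \<Rightarrow> 'v::ab_group_add \<Rightarrow> 'v" +
  fixes ip :: "'v \<Rightarrow> 'v \<Rightarrow> 'k"
  assumes finite_dim: "\<exists>B. finite B \<and> span B = UNIV"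
    and ip_add_right: "ip x (y + z) = ip x y + ip x z"
    and ip_scale_right: "ip x (scale c y) = c * ip x y"
    and ip_conjugate: "ip y x = conjugate (ip x y)"
    and ip_positive: "x \<noteq> 0 \<Longrightarrow> \<exists>r>0. ip x x = of_real r"
begin

lemma ip_add_left: "ip (x + y) z = ip x z + ip y z"
  using ip_add_right ip_conjugate conjugate_dist_add by metis

lemma ip_scale_left: "ip (scale c x) y = conjugate c * ip x y"
  using ip_scale_right ip_conjugate conjugate_dist_mul by metis

end


section \<open>The exterior algebra\<close>

text \<open>The free associative unital algebra on the set \<open>X\<close> is the monoid algebra of the monoid of
  words in \<open>X\<close>; as finitely supported functions on an additively written monoid,
  \<open>Poly_Mapping\<close> provides its convolution product.\<close>

datatype 'v fword = Word (letters: "'v list")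

instantiation fword :: (type) monoid_add
begin
definition zero_fword :: "'a fword" where "zero_fword = Word []"
definition plus_fword :: "'a fword \<Rightarrow> 'a fword \<Rightarrow> 'a fword"
  where "plus_fword u w = Word (letters u @ letters w)"
instance by standard (simp_all add: zero_fword_def plus_fword_def)
end

type_synonym ('v, 'k) free_alg = "'v fword \<Rightarrow>\<^sub>0 'k"

definition free_algebra :: "('v, 'k::ring_1) free_alg ring" where
  "free_algebra = \<lparr>carrier = UNIV, monoid.mult = (*), one = 1, zero = 0, add = (+)\<rparr>"

definition letter :: "'v \<Rightarrow> ('v, 'k::ring_1) free_alg" where
  "letter v = Poly_Mapping.single (Word [v]) 1"

definition scalar :: "'k::ring_1 \<Rightarrow> ('v, 'k) free_alg" where
  "scalar c = Poly_Mapping.single 0 c"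

text \<open>The first two families of relations turn the free algebra on the set \<open>X\<close> into the tensor
  algebra of the vector space \<open>X\<close>, the third one turns the latter into the exterior algebra.\<close>

definition ext_relations ::
  "('k::ring_1 \<Rightarrow> 'v::ab_group_add \<Rightarrow> 'v) \<Rightarrow> ('v, 'k) free_alg set" where
  "ext_relations scale =
     {letter (x + y) - letter x - letter y | x y. True} \<union>
     {letter (scale c x) - scalar c * letter x | c x. True} \<union>
     {letter x * letter x | x. True}"

definition ext_ideal ::
  "('k::ring_1 \<Rightarrow> 'v::ab_group_add \<Rightarrow> 'v) \<Rightarrow> ('v, 'k) free_alg set" where
  "ext_ideal scale = genideal free_algebra (ext_relations scale)"

definition ext_alg ::
  "('k::ring_1 \<Rightarrow> 'v::ab_group_add \<Rightarrow> 'v) \<Rightarrow> ('v, 'k) free_alg set ring" where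
  "ext_alg scale = free_algebra Quot (ext_ideal scale)"

definition ext_class ::
  "('k::ring_1 \<Rightarrow> 'v::ab_group_add \<Rightarrow> 'v) \<Rightarrow> ('v, 'k) free_alg \<Rightarrow> ('v, 'k) free_alg set" where
  "ext_class scale a = ext_ideal scale +>\<^bsub>free_algebra\<^esub> a"

definition blade ::
  "('k::ring_1 \<Rightarrow> 'v::ab_group_add \<Rightarrow> 'v) \<Rightarrow> 'v list \<Rightarrow> ('v, 'k) free_alg set" where
  "blade scale vs =
     foldr (\<lambda>v M. ext_class scale (letter v) \<otimes>\<^bsub>ext_alg scale\<^esub> M) vs \<one>\<^bsub>ext_alg scale\<^esub>"


section \<open>Inner product, norm and left contraction\<close>

definition gram_mat :: "('v \<Rightarrow> 'v \<Rightarrow> 'k) \<Rightarrow> 'v list \<Rightarrow> 'v list \<Rightarrow> 'k mat" where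
  "gram_mat ip vs ws = mat (length vs) (length ws) (\<lambda>(i, j). ip (vs ! i) (ws ! j))"

definition word_form :: "('v \<Rightarrow> 'v \<Rightarrow> 'k::rc_scalar) \<Rightarrow> 'v fword \<Rightarrow> 'v fword \<Rightarrow> 'k" where
  "word_form ip u w =
     (if length (letters u) = length (letters w) then det (gram_mat ip (letters u) (letters w))
      else 0)"

definition free_form ::
  "('v \<Rightarrow> 'v \<Rightarrow> 'k::rc_scalar) \<Rightarrow> ('v, 'k) free_alg \<Rightarrow> ('v, 'k) free_alg \<Rightarrow> 'k" where
  "free_form ip a b =
     (\<Sum>u\<in>Poly_Mapping.keys a. \<Sum>w\<in>Poly_Mapping.keys b. conjugate (Poly_Mapping.lookup a u) * Poly_Mapping.lookup b w * word_form ip u w)"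

text \<open>The values do not depend on the chosen representatives, see \<open>ext_inner_class\<close> below.\<close>

definition ext_inner ::
  "('v \<Rightarrow> 'v \<Rightarrow> 'k::rc_scalar) \<Rightarrow> ('v, 'k) free_alg set \<Rightarrow> ('v, 'k) free_alg set \<Rightarrow> 'k" where
  "ext_inner ip M N = free_form ip (SOME a. a \<in> M) (SOME b. b \<in> N)"

definition ext_norm :: "('v \<Rightarrow> 'v \<Rightarrow> 'k::rc_scalar) \<Rightarrow> ('v, 'k) free_alg set \<Rightarrow> real" where
  "ext_norm ip M = sqrt (real_part (ext_inner ip M M))"

definition left_contraction ::
  "('k::rc_scalar \<Rightarrow> 'v::ab_group_add \<Rightarrow> 'v) \<Rightarrow> ('v \<Rightarrow> 'v \<Rightarrow> 'k) \<Rightarrow>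
    ('v, 'k) free_alg set \<Rightarrow> ('v, 'k) free_alg set \<Rightarrow> ('v, 'k) free_alg set" where
  "left_contraction scale ip M N =
     (THE K. K \<in> carrier (ext_alg scale) \<and>
       (\<forall>L\<in>carrier (ext_alg scale).
          ext_inner ip L K = ext_inner ip (M \<otimes>\<^bsub>ext_alg scale\<^esub> L) N))"


section \<open>The inner product is well defined\<close>

lemma free_algebra_simps [simp]:
  "carrier free_algebra = UNIV" "monoid.mult free_algebra = (*)" "one free_algebra = 1"
  "zero free_algebra = 0" "add free_algebra = (+)"
  by (simp_all add: free_algebra_def)

lemma ring_free_algebra: "ring (free_algebra :: ('v, 'k::ring_1) free_alg ring)"
proof (rule ringI)
  show "abelian_group (free_algebra :: ('v, 'k) free_alg ring)"
    by (rule abelian_groupI) (auto simp: algebra_simps intro: exI[of _ "- _"])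
  show "Group.monoid (free_algebra :: ('v, 'k) free_alg ring)"
    by (rule Group.monoidI) (auto simp: algebra_simps)
qed (auto simp: algebra_simps)

lemma ideal_ext_ideal: "ideal (ext_ideal scale) free_algebra"
  unfolding ext_ideal_def by (rule ring.genideal_ideal[OF ring_free_algebra]) simp

lemma ext_class_eq: "ext_class scale a = {x + a | x. x \<in> ext_ideal scale}"
  by (auto simp: ext_class_def a_r_coset_def r_coset_def)

lemma free_form_eq:
  assumes "finite S" "Poly_Mapping.keys a \<subseteq> S" "finite T" "Poly_Mapping.keys b \<subseteq> T"
  shows "free_form ip a b =
    (\<Sum>u\<in>S. \<Sum>w\<in>T. conjugate (Poly_Mapping.lookup a u) * Poly_Mapping.lookup b w * word_form ip u w)"
proof -
  have "(\<Sum>w\<in>Poly_Mapping.keys b. conjugate (Poly_Mapping.lookup a u) * Poly_Mapping.lookup b w * word_form ip u w) =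
        (\<Sum>w\<in>T. conjugate (Poly_Mapping.lookup a u) * Poly_Mapping.lookup b w * word_form ip u w)" for u
    by (rule sum.mono_neutral_left) (use assms in \<open>auto simp: in_keys_iff\<close>)
  then have "free_form ip a b =
      (\<Sum>u\<in>Poly_Mapping.keys a. \<Sum>w\<in>T. conjugate (Poly_Mapping.lookup a u) * Poly_Mapping.lookup b w * word_form ip u w)"
    by (simp add: free_form_def)
  also have "\<dots> = (\<Sum>u\<in>S. \<Sum>w\<in>T. conjugate (Poly_Mapping.lookup a u) * Poly_Mapping.lookup b w * word_form ip u w)"
    by (rule sum.mono_neutral_left) (use assms in \<open>auto simp: in_keys_iff\<close>)
  finally show ?thesis .
qed

lemma free_form_add_left: "free_form ip (a + a') b = free_form ip a b + free_form ip a' b"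
proof -
  let ?S = "Poly_Mapping.keys a \<union> Poly_Mapping.keys a'"
  have "Poly_Mapping.keys (a + a') \<subseteq> ?S" by (rule keys_add)
  then have "free_form ip (a + a') b = (\<Sum>u\<in>?S. \<Sum>w\<in>Poly_Mapping.keys b.
      conjugate (Poly_Mapping.lookup (a + a') u) * Poly_Mapping.lookup b w * word_form ip u w)"
    by (intro free_form_eq) auto
  also have "\<dots> = (\<Sum>u\<in>?S. \<Sum>w\<in>Poly_Mapping.keys b. conjugate (Poly_Mapping.lookup a u) * Poly_Mapping.lookup b w * word_form ip u w) +
      (\<Sum>u\<in>?S. \<Sum>w\<in>Poly_Mapping.keys b. conjugate (Poly_Mapping.lookup a' u) * Poly_Mapping.lookup b w * word_form ip u w)"
    by (simp add: lookup_add conjugate_dist_add distrib_right sum.distrib)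
  also have "\<dots> = free_form ip a b + free_form ip a' b"
    by (simp add: free_form_eq[of ?S _ "Poly_Mapping.keys b"])
  finally show ?thesis .
qed

lemma free_form_add_right: "free_form ip a (b + b') = free_form ip a b + free_form ip a b'"
proof -
  let ?T = "Poly_Mapping.keys b \<union> Poly_Mapping.keys b'"
  have "Poly_Mapping.keys (b + b') \<subseteq> ?T" by (rule keys_add)
  then have "free_form ip a (b + b') = (\<Sum>u\<in>Poly_Mapping.keys a. \<Sum>w\<in>?T.
      conjugate (Poly_Mapping.lookup a u) * Poly_Mapping.lookup (b + b') w * word_form ip u w)"
    by (intro free_form_eq) auto
  also have "\<dots> = (\<Sum>u\<in>Poly_Mapping.keys a. \<Sum>w\<in>?T. conjugate (Poly_Mapping.lookup a u) * Poly_Mapping.lookup b w * word_form ip u w) +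
      (\<Sum>u\<in>Poly_Mapping.keys a. \<Sum>w\<in>?T. conjugate (Poly_Mapping.lookup a u) * Poly_Mapping.lookup b' w * word_form ip u w)"
    by (simp add: lookup_add distrib_right distrib_left sum.distrib)
  also have "\<dots> = free_form ip a b + free_form ip a b'"
    by (simp add: free_form_eq[of "Poly_Mapping.keys a" _ ?T])
  finally show ?thesis .
qed

lemma free_form_zero_left [simp]: "free_form ip 0 b = 0"
  by (simp add: free_form_def)

lemma free_form_zero_right [simp]: "free_form ip a 0 = 0"
  by (simp add: free_form_def)

lemma free_form_uminus_left: "free_form ip (- a) b = - free_form ip a b"
  using free_form_add_left[of ip "- a" a b] by (simp add: eq_neg_iff_add_eq_0)

lemma free_form_diff_left: "free_form ip (a - a') b = free_form ip a b - free_form ip a' b"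
  using free_form_add_left[of ip a "- a'" b] by (simp add: free_form_uminus_left)

lemma free_form_single:
  "free_form ip (Poly_Mapping.single u c) (Poly_Mapping.single w d) =
     conjugate c * d * word_form ip u w"
  by (subst free_form_eq[of "{u}" _ "{w}"]) (auto simp: lookup_single)

lemma free_alg_induct [case_names zero single add]:
  fixes a :: "('v, 'k::ring_1) free_alg"
  assumes "P 0" "\<And>u c. P (Poly_Mapping.single u c)" "\<And>a b. P a \<Longrightarrow> P b \<Longrightarrow> P (a + b)"
  shows "P a"
proof (induction a rule: update_induct)
  case (update f u c)
  have "Poly_Mapping.update u c f = f + Poly_Mapping.single u c"
    by (rule poly_mapping_eqI)
      (use update(1) in \<open>auto simp: lookup_update lookup_add lookup_single in_keys_iff when_def\<close>)
  then show ?case using update assms by metis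
qed (fact assms(1))

lemma conjugate_one: "conjugate (1 :: 'k::rc_scalar) = 1"
  using conjugate_mult_self[of "1 :: 'k"] by simp

lemma word_plus [simp]: "Word u + Word w = Word (u @ w)"
  by (simp add: plus_fword_def)

context fin_inner_space
begin

lemma word_form_row:
  assumes "length vs = n" "length r + Suc (length s) = n"
  shows "det (gram_mat ip (r @ (x + y) # s) vs) =
           det (gram_mat ip (r @ x # s) vs) + det (gram_mat ip (r @ y # s) vs)" (is ?add)
    and "det (gram_mat ip (r @ scale c x # s) vs) =
           conjugate c * det (gram_mat ip (r @ x # s) vs)" (is ?scale)
proof -
  let ?k = "length r"
  let ?G = "\<lambda>z. gram_mat ip (r @ z # s) vs"
  have k: "?k < n" using assms by simp
  have G: "?G z \<in> carrier_mat n n" for z using assms by (simp add: gram_mat_def)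
  have cof: "cofactor (?G z) ?k j = cofactor (?G z') ?k j" if "j < n" for z z' j
  proof -
    have "mat_delete (?G z) ?k j = mat_delete (?G z') ?k j"
      by (rule eq_matI) (use assms k in \<open>auto simp: mat_delete_def gram_mat_def nth_append\<close>)
    then show ?thesis by (simp add: cofactor_def)
  qed
  have lap: "det (?G z) = (\<Sum>j<n. ip z (vs ! j) * cofactor (?G 0) ?k j)" for z
  proof -
    have "?G z $$ (?k, j) = ip z (vs ! j)" if "j < n" for j
      using assms k that by (simp add: gram_mat_def)
    then show ?thesis
      unfolding laplace_expansion_row[OF G k]
      by (intro sum.cong refl) (simp add: cof[of _ z 0])
  qed
  show ?add unfolding lap by (simp add: ip_add_left distrib_right sum.distrib)
  show ?scale unfolding lap by (simp add: ip_scale_left sum_distrib_left mult.assoc)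
qed

lemma word_form_alternating:
  assumes "length vs = length r + Suc (Suc (length s))"
  shows "det (gram_mat ip (r @ x # x # s) vs) = 0"
proof (rule det_identical_rows)
  show "gram_mat ip (r @ x # x # s) vs \<in> carrier_mat (length vs) (length vs)"
    using assms by (simp add: gram_mat_def)
  show "length r \<noteq> Suc (length r)" "length r < length vs" "Suc (length r) < length vs"
    using assms by auto
  show "row (gram_mat ip (r @ x # x # s) vs) (length r) =
        row (gram_mat ip (r @ x # x # s) vs) (Suc (length r))"
    by (rule eq_vecI) (use assms in \<open>auto simp: gram_mat_def nth_append\<close>)
qed

lemma relation_single:
  assumes "a \<in> ext_relations scale"
  shows "free_form ip (Poly_Mapping.single u c * a * Poly_Mapping.single w d)
    (Poly_Mapping.single z e) = 0"
proof -
  obtain r s t where [simp]: "u = Word r" "w = Word s" "z = Word t"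
    by (metis fword.exhaust)
  from assms consider
    (add) x y where "a = letter (x + y) - letter x - letter y"
  | (scale) b x where "a = letter (scale b x) - scalar b * letter x"
  | (alt) x where "a = letter x * letter x"
    unfolding ext_relations_def by blast
  then show ?thesis
  proof cases
    case add
    show ?thesis
      by (auto simp: add letter_def mult_single algebra_simps free_form_diff_left
          free_form_add_left free_form_single word_form_def word_form_row)
  next
    case scale
    have "(scalar b :: ('v,'k) free_alg) = Poly_Mapping.single (Word []) b"
      by (simp add: scalar_def zero_fword_def)
    then show ?thesis
      by (auto simp: scale letter_def mult_single algebra_simps free_form_diff_left
          free_form_add_left free_form_single word_form_def word_form_row conjugate_dist_mul)
  next
    case alt
    show ?thesis
      by (auto simp: alt letter_def mult_single free_form_single word_form_def
          word_form_alternating)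
  qed
qed

lemma relation_orthogonal:
  assumes a: "a \<in> ext_relations scale"
  shows "free_form ip (x * a * y) b = 0"
proof (induction x rule: free_alg_induct)
  case (single u c)
  show ?case
  proof (induction y rule: free_alg_induct)
    case (single w d)
    show ?case
      by (induction b rule: free_alg_induct)
        (simp_all add: relation_single[OF a] free_form_add_right)
  qed (simp_all add: distrib_left free_form_add_left)
qed (simp_all add: distrib_right free_form_add_left)

lemma ext_ideal_orthogonal:
  assumes "a \<in> ext_ideal scale"
  shows "free_form ip a b = 0"
proof -
  define K where "K = {a. \<forall>x y b. free_form ip (x * a * y) b = 0}"
  have "ideal K free_algebra"
  proof (rule idealI[OF ring_free_algebra])
    show "subgroup K (add_monoid free_algebra)"
    proof (rule group.subgroupI)
      show "group (add_monoid free_algebra)"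
        by (rule abelian_group.a_group[OF ring.is_abelian_group[OF ring_free_algebra]])
      show "K \<noteq> {}" by (auto simp: K_def intro!: exI[of _ 0])
    next
      fix k assume k: "k \<in> K"
      have "abelian_group free_algebra"
        by (rule ring.is_abelian_group[OF ring_free_algebra])
      then have "\<ominus>\<^bsub>free_algebra\<^esub> k = - k"
        by (rule abelian_group.minus_equality) auto
      then show "inv\<^bsub>add_monoid free_algebra\<^esub> k \<in> K"
        using k by (simp add: a_inv_def K_def free_form_uminus_left)
    qed (auto simp: K_def distrib_left distrib_right free_form_add_left)
  next
    fix k z assume k: "k \<in> K"
    then show "z \<otimes>\<^bsub>free_algebra\<^esub> k \<in> K"
      unfolding K_def by (simp flip: mult.assoc)
    have "x * (k * z) * y = x * k * (z * y)" for x y by (simp add: mult.assoc)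
    with k show "k \<otimes>\<^bsub>free_algebra\<^esub> z \<in> K"
      unfolding K_def by simp
  qed
  moreover have "ext_relations scale \<subseteq> K"
    by (auto simp: K_def relation_orthogonal)
  ultimately have "ext_ideal scale \<subseteq> K"
    unfolding ext_ideal_def by (rule ring.genideal_minimal[OF ring_free_algebra])
  with assms have "free_form ip (1 * a * 1) b = 0" unfolding K_def by blast
  then show ?thesis by simp
qed

lemma word_form_conjugate: "word_form ip w u = conjugate (word_form ip u w)"
proof (cases "length (letters u) = length (letters w)")
  case True
  let ?G = "gram_mat ip (letters u) (letters w)"
  interpret cnj: comm_ring_hom "conjugate :: 'k \<Rightarrow> 'k"
    by unfold_locales (simp_all add: conjugate_one conjugate_dist_mul conjugate_dist_add)
  have "gram_mat ip (letters w) (letters u) = transpose_mat (map_mat conjugate ?G)"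
    by (rule eq_matI) (auto simp: gram_mat_def ip_conjugate[symmetric])
  moreover have "map_mat conjugate ?G \<in> carrier_mat (length (letters u)) (length (letters u))"
    using True by (simp add: gram_mat_def)
  ultimately have "det (gram_mat ip (letters w) (letters u)) = conjugate (det ?G)"
    by (simp add: det_transpose)
  then show ?thesis using True by (simp add: word_form_def)
qed (simp add: word_form_def)

lemma free_form_conjugate: "free_form ip b a = conjugate (free_form ip a b)"
proof -
  have "conjugate (Poly_Mapping.lookup b u) * Poly_Mapping.lookup a w * word_form ip u w =
        conjugate (conjugate (Poly_Mapping.lookup a w) * Poly_Mapping.lookup b u * word_form ip w u)" for u w
    using word_form_conjugate[of u w] by (simp add: conjugate_dist_mul)
  then show ?thesis
    unfolding free_form_def sum_conjugate[OF finite_keys] by (simp add: sum.swap[of _ "Poly_Mapping.keys a"])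
qed

lemma ext_inner_class:
  "ext_inner ip (ext_class scale a) (ext_class scale b) = free_form ip a b"
proof -
  have zero: "0 \<in> ext_ideal scale"
    using additive_subgroup.zero_closed[OF ideal.axioms(1)[OF ideal_ext_ideal]] by simp
  have some: "\<exists>x\<in>ext_ideal scale. (SOME a'. a' \<in> ext_class scale a) = x + a" for a
  proof -
    have "(SOME a'. a' \<in> ext_class scale a) \<in> ext_class scale a"
      by (rule someI[of _ a]) (use zero in \<open>auto simp: ext_class_eq\<close>)
    then show ?thesis by (auto simp: ext_class_eq)
  qed
  have orth: "free_form ip c x = 0" if "x \<in> ext_ideal scale" for c x
    using ext_ideal_orthogonal[OF that, of c] free_form_conjugate[of c x] by simp
  obtain x y where "x \<in> ext_ideal scale" "y \<in> ext_ideal scale"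
    "(SOME a'. a' \<in> ext_class scale a) = x + a" "(SOME b'. b' \<in> ext_class scale b) = y + b"
    using some by meson
  then show ?thesis
    by (simp add: ext_inner_def free_form_add_left free_form_add_right orth ext_ideal_orthogonal)
qed

lemma blade_eq: "blade scale vs = ext_class scale (Poly_Mapping.single (Word vs) 1)"
proof (induction vs)
  case Nil
  show ?case by (simp add: blade_def ext_alg_def FactRing_def ext_class_def
        flip: zero_fword_def)
next
  case (Cons v vs)
  have "blade scale (v # vs) = ext_class scale (letter v) \<otimes>\<^bsub>ext_alg scale\<^esub> blade scale vs"
    by (simp add: blade_def)
  also have "\<dots> = ext_class scale (letter v * Poly_Mapping.single (Word vs) 1)"
    using ideal.rcoset_mult_add[OF ideal_ext_ideal]
    by (simp add: Cons.IH ext_alg_def FactRing_def ext_class_def)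
  also have "\<dots> = ext_class scale (Poly_Mapping.single (Word (v # vs)) 1)"
    by (simp add: letter_def mult_single)
  finally show ?case .
qed

lemma ext_inner_blade:
  "ext_inner ip (blade scale vs) (blade scale ws) =
     (if length vs = length ws then det (gram_mat ip vs ws) else 0)"
  by (simp add: blade_eq ext_inner_class free_form_single word_form_def conjugate_one)

end

end

theory Submission
  imports Defs
begin

text \<open>
  Let \<open>K = A \<lrcorner> B\<close>. The idea is to make \<open>K\<close> explicit by Laplace expansion and then to read the
  determinant of the block matrix as \<open>\<langle>K, K\<rangle>\<close>, again by Laplace expansion.

  Expanding the Gram determinant \<open>\<langle>v \<and> L, w\<^sub>1 \<and> \<dots> \<and> w\<^sub>q\<rangle>\<close> along its first row removes \<open>v\<close> from the
  left and one \<open>w\<^sub>j\<close> from the right, so contraction by \<open>v\<close> is a signed sum over the \<open>w\<^sub>j\<close>, and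
  iterating over \<open>v\<^sub>1, \<dots>, v\<^sub>p\<close> gives a candidate for \<open>K\<close> (\<open>contract\<close>, \<open>contract_adjoint\<close>).
  It is the only candidate because the inner product is definite. This, like the
  nonnegativity of \<open>\<langle>K, K\<rangle>\<close>, comes from an orthonormal basis \<open>e\<^sub>0, \<dots>, e\<^sub>n\<^sub>-\<^sub>1\<close> of \<open>X\<close>: sorting the
  letters shows that the increasing products of basis vectors span the exterior algebra
  (\<open>basis_words_span\<close>), and they are orthonormal (\<open>basis_words_orthonormal\<close>).

  The block matrix enters in \<open>free_form_contract\<close>, which treats the more general product
  \<open>\<langle>A \<lrcorner> B, A' \<lrcorner> B'\<rangle>\<close> with independent lists of vectors, so that \<open>A\<close> can be used up by induction
  while \<open>A'\<close> stays. A first vector \<open>v\<close> of \<open>A\<close> is the first column of the matrix; this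
  column vanishes in the rows of \<open>A'\<close>, and the expansion along it is precisely the sum that
  defines the contraction by \<open>v\<close>. Once \<open>A\<close> is empty the matrix is the Gram matrix of
  \<open>A' \<and> B\<close> and \<open>B'\<close>, whose determinant is \<open>\<langle>B, A' \<lrcorner> B'\<rangle>\<close> by adjointness. The signs add up to
  \<open>(-1)\<close> to the power \<open>p\<^sup>2\<close> for \<open>A = A'\<close>, and the absolute value removes it.
\<close>


section \<open>Real scalars\<close>

lemma conjugate_of_real: "conjugate (of_real r :: 'k::rc_scalar) = of_real r"
proof (cases "r = 0")
  case False
  have "conjugate (of_real r :: 'k) * of_real r = of_real r * of_real r"
    using conjugate_mult_self[of "of_real r :: 'k"]
    by (simp add: scaleR_conv_of_real power2_eq_square flip: of_real_mult)
  then show ?thesis using False by simp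
qed (simp)

lemma real_part_of_real: "real_part (of_real r :: 'k::rc_scalar) = r"
proof -
  have "(2 * real_part (of_real r :: 'k)) *\<^sub>R (1 :: 'k) = of_real (2 * r)"
    using real_part[of "of_real r :: 'k"] by (simp add: conjugate_of_real)
  then have "of_real (2 * real_part (of_real r :: 'k)) = (of_real (2 * r) :: 'k)"
    by (simp add: scaleR_conv_of_real)
  then show ?thesis by (simp only: of_real_eq_iff)
qed

lemma conjugate_minus_one_power: "conjugate ((- 1) ^ n :: 'k::rc_scalar) = (- 1) ^ n"
  using conjugate_of_real[of "(- 1) ^ n", where 'k='k] by simp


section \<open>Sesquilinearity over the scalars of the free algebra\<close>

lemma scalar_mult_single: "scalar c * Poly_Mapping.single w d = Poly_Mapping.single w (c * d)"
  by (simp add: scalar_def mult_single)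

lemma free_form_scalar_right: "free_form ip a (scalar c * b) = c * free_form ip a b"
proof (induction b rule: free_alg_induct)
  case (single w d)
  show ?case
    by (induction a rule: free_alg_induct)
      (simp_all add: scalar_mult_single free_form_single free_form_add_left algebra_simps)
qed (simp_all add: free_form_add_right distrib_left)

lemma free_form_scalar_left: "free_form ip (scalar c * a) b = conjugate c * free_form ip a b"
proof (induction b rule: free_alg_induct)
  case (single w d)
  show ?case
    by (induction a rule: free_alg_induct)
      (simp_all add: scalar_mult_single free_form_single free_form_add_left conjugate_dist_mul
        algebra_simps)
qed (simp_all add: free_form_add_right distrib_left)

lemma free_form_sum_left: "free_form ip (sum f S) b = (\<Sum>i\<in>S. free_form ip (f i) b)"
  by (induction S rule: infinite_finite_induct) (simp_all add: free_form_add_left)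

lemma free_form_sum_right: "free_form ip a (sum f S) = (\<Sum>i\<in>S. free_form ip a (f i))"
  by (induction S rule: infinite_finite_induct) (simp_all add: free_form_add_right)

lemma letter_mult_word:
  "letter x * Poly_Mapping.single (Word xs) c = Poly_Mapping.single (Word (x # xs)) c"
  by (simp add: letter_def mult_single)


section \<open>Calculating modulo the defining relations\<close>

lemma ext_ideal_zero: "0 \<in> ext_ideal scale"
  using additive_subgroup.zero_closed[OF ideal.axioms(1)[OF ideal_ext_ideal]] by simp

lemma ext_ideal_add: "a \<in> ext_ideal scale \<Longrightarrow> b \<in> ext_ideal scale \<Longrightarrow> a + b \<in> ext_ideal scale"
  using additive_subgroup.a_closed[OF ideal.axioms(1)[OF ideal_ext_ideal]] by fastforce

lemma ext_ideal_mult_left: "a \<in> ext_ideal scale \<Longrightarrow> x * a \<in> ext_ideal scale"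
  using ideal.I_l_closed[OF ideal_ext_ideal, of a scale x] by simp

lemma ext_ideal_mult_right: "a \<in> ext_ideal scale \<Longrightarrow> a * x \<in> ext_ideal scale"
  using ideal.I_r_closed[OF ideal_ext_ideal, of a scale x] by simp

lemma ext_ideal_uminus: "a \<in> ext_ideal scale \<Longrightarrow> - a \<in> ext_ideal scale"
  using ext_ideal_mult_left[of a scale "- 1"] by simp

lemma ext_ideal_diff: "a \<in> ext_ideal scale \<Longrightarrow> b \<in> ext_ideal scale \<Longrightarrow> a - b \<in> ext_ideal scale"
  using ext_ideal_add[of a scale "- b"] ext_ideal_uminus by auto

lemma ext_ideal_relation: "a \<in> ext_relations scale \<Longrightarrow> a \<in> ext_ideal scale"
  unfolding ext_ideal_def using ring.genideal_self[OF ring_free_algebra, of "ext_relations scale"]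
  by auto

lemma ext_class_eqI: "a - b \<in> ext_ideal scale \<Longrightarrow> ext_class scale a = ext_class scale b"
proof -
  assume ab: "a - b \<in> ext_ideal scale"
  have "\<exists>y\<in>ext_ideal scale. x + a = y + b" if "x \<in> ext_ideal scale" for x
    using ext_ideal_add[OF that ab] by (intro bexI[of _ "x + (a - b)"]) auto
  moreover have "\<exists>y\<in>ext_ideal scale. x + b = y + a" if "x \<in> ext_ideal scale" for x
    using ext_ideal_diff[OF that ab] by (intro bexI[of _ "x - (a - b)"]) auto
  ultimately show ?thesis by (auto simp: ext_class_eq)
qed

lemma carrier_ext_alg: "carrier (ext_alg scale) = range (ext_class scale)"
  by (auto simp: ext_alg_def FactRing_def ext_class_def A_RCOSETS_def')

lemma ext_class_mult:
  "ext_class scale a \<otimes>\<^bsub>ext_alg scale\<^esub> ext_class scale b = ext_class scale (a * b)"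
  using ideal.rcoset_mult_add[OF ideal_ext_ideal]
  by (simp add: ext_alg_def FactRing_def ext_class_def)

text \<open>Polarising \<open>x \<and> x = 0\<close> at \<open>x + y\<close>. In the free algebra \<open>letter (x + y)\<close> is only congruent
  to \<open>letter x + letter y\<close>, so the difference of the two squares is split off as a
  member of the ideal.\<close>

lemma letters_anticommute: "letter x * letter y + letter y * letter x \<in> ext_ideal scale"
proof -
  let ?I = "ext_ideal scale"
  let ?L = "letter (x + y)" and ?X = "letter x" and ?Y = "letter y"
  have square: "letter z * letter z \<in> ?I" for z
    by (rule ext_ideal_relation) (auto simp: ext_relations_def)
  have "?L - ?X - ?Y \<in> ?I"
    by (rule ext_ideal_relation) (auto simp: ext_relations_def)
  then have D: "?L - (?X + ?Y) \<in> ?I" by (simp add: algebra_simps)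
  have "?L * ?L - ?X * ?X - ?Y * ?Y - ((?L - (?X + ?Y)) * ?L + (?X + ?Y) * (?L - (?X + ?Y))) \<in> ?I"
    by (intro ext_ideal_diff ext_ideal_add square ext_ideal_mult_left[OF D] ext_ideal_mult_right[OF D])
  then show ?thesis by (simp add: algebra_simps)
qed


context fin_inner_space
begin

section \<open>Orthonormal bases\<close>

lemma ip_zero_right: "ip x 0 = 0"
  using ip_scale_right[of x 0 0] by simp

lemma ip_sum_right: "ip x (sum f S) = (\<Sum>i\<in>S. ip x (f i))"
  by (induction S rule: infinite_finite_induct) (simp_all add: ip_add_right ip_zero_right)

lemma ip_diff_right: "ip x (y - z) = ip x y - ip x z"
  using ip_add_right[of x "y - z" z] by simp

definition orthonormal :: "(nat \<Rightarrow> 'v) \<Rightarrow> nat \<Rightarrow> bool" where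
  "orthonormal e n \<longleftrightarrow> (\<forall>i<n. \<forall>j<n. ip (e i) (e j) = of_bool (i = j))"

lemma gram_schmidt:
  "finite B \<Longrightarrow> \<exists>e n. orthonormal e n \<and> span (e ` {..<n}) = span B"
proof (induction B rule: finite_induct)
  case empty
  show ?case by (rule exI[of _ "\<lambda>_. 0"], rule exI[of _ 0]) (simp add: orthonormal_def)
next
  case (insert x B)
  then obtain e n where e: "orthonormal e n" and sp: "span (e ` {..<n}) = span B" by blast
  let ?E = "e ` {..<n}"
  have spx: "span (insert x ?E) = span (insert x B)"
    unfolding span_insert sp ..
  define s where "s = (\<Sum>i<n. scale (ip (e i) x) (e i))"
  have s: "s \<in> span ?E"
    unfolding s_def by (intro span_sum span_scale span_base) auto
  show ?case
  proof (cases "x - s = 0")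
    \<comment> \<open>As \<open>B\<close> may be linearly dependent, the projection can exhaust \<open>x\<close>; then the old basis is kept.\<close>
    case True
    then have "x \<in> span ?E" using s by simp
    then have "span (insert x ?E) = span ?E" by (rule span_redundant)
    then show ?thesis using e spx by metis
  next
    case False
    then obtain r where r: "r > 0" "ip (x - s) (x - s) = of_real r" using ip_positive by blast
    define c where "c = (of_real (1 / sqrt r) :: 'k)"
    define z where "z = scale c (x - s)"
    have c0: "c \<noteq> 0" using r by (simp add: c_def)
    have perp: "ip (e i) (x - s) = 0" if "i < n" for i
    proof -
      have "ip (e i) s = (\<Sum>j<n. ip (e j) x * ip (e i) (e j))"
        by (simp add: s_def ip_sum_right ip_scale_right)
      also have "\<dots> = (\<Sum>j<n. if j = i then ip (e j) x else 0)"
        by (intro sum.cong refl) (use e that in \<open>auto simp: orthonormal_def\<close>)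
      also have "\<dots> = ip (e i) x" using that by simp
      finally show ?thesis by (simp add: ip_diff_right)
    qed
    have ez: "ip (e i) z = 0" if "i < n" for i
      using perp[OF that] by (simp add: z_def ip_scale_right)
    have ze: "ip z (e i) = 0" if "i < n" for i
      using ez[OF that] ip_conjugate[of z "e i"] by simp
    have "ip z z = of_real (1 / sqrt r) * (of_real (1 / sqrt r) * of_real r)"
      unfolding z_def ip_scale_right ip_scale_left r(2) c_def conjugate_of_real ..
    also have "\<dots> = of_real (1 / sqrt r * (1 / sqrt r * r))"
      by (simp only: of_real_mult)
    also have "1 / sqrt r * (1 / sqrt r * r) = 1"
      using r by simp
    finally have zz: "ip z z = 1" by simp
    have "orthonormal (e(n := z)) (Suc n)"
      using e by (auto simp: orthonormal_def less_Suc_eq ez ze zz)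
    moreover have "span (e(n := z) ` {..<Suc n}) = span (insert x B)"
    proof -
      have "e(n := z) ` {..<Suc n} = insert z ?E"
        by (auto simp: lessThan_Suc)
      moreover have "span (insert z ?E) = span (insert x ?E)"
        unfolding span_eq
      proof (intro conjI insert_subsetI)
        have "s \<in> span (insert x ?E)" using s span_mono[of ?E "insert x ?E"] by blast
        then show "z \<in> span (insert x ?E)"
          unfolding z_def by (intro span_scale span_diff) (auto intro: span_base)
        have "s \<in> span (insert z ?E)" using s span_mono[of ?E "insert z ?E"] by blast
        moreover have "x = scale (inverse c) z + s"
          using c0 by (simp add: z_def)
        ultimately show "x \<in> span (insert z ?E)"
          by (metis span_add span_scale span_base insertI1)
      qed (auto intro: span_base)
      ultimately show ?thesis using spx by simp
    qed
    ultimately show ?thesis by blast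
  qed
qed

lemma orthonormal_basis_exists: "\<exists>e n. orthonormal e n \<and> span (e ` {..<n}) = UNIV"
  using finite_dim gram_schmidt by metis


section \<open>The standard basis of the exterior algebra\<close>

definition increasing_lists :: "nat \<Rightarrow> nat list set" where
  "increasing_lists n = {l. sorted_wrt (<) l \<and> set l \<subseteq> {..<n}}"

lemma finite_increasing_lists: "finite (increasing_lists n)"
proof (rule finite_subset)
  show "increasing_lists n \<subseteq> {l. set l \<subseteq> {..<n} \<and> distinct l}"
    by (auto simp: increasing_lists_def strict_sorted_iff)
qed (auto intro: finite_subset_distinct)

definition basis_comb :: "(nat \<Rightarrow> 'v) \<Rightarrow> nat \<Rightarrow> (nat list \<Rightarrow> 'k) \<Rightarrow> ('v, 'k) free_alg" where
  "basis_comb e n c = (\<Sum>l\<in>increasing_lists n. Poly_Mapping.single (Word (map e l)) (c l))"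

text \<open>Reducible elements are those whose class lies in the span of the increasing products of
  the \<open>e i\<close>; that span is an explicit sum here, which makes its coefficients available.\<close>

definition reducible :: "(nat \<Rightarrow> 'v) \<Rightarrow> nat \<Rightarrow> ('v, 'k) free_alg \<Rightarrow> bool" where
  "reducible e n a \<longleftrightarrow> (\<exists>c. a - basis_comb e n c \<in> ext_ideal scale)"

lemma reducible_cong: "a - b \<in> ext_ideal scale \<Longrightarrow> reducible e n b \<Longrightarrow> reducible e n a"
  unfolding reducible_def using ext_ideal_add[of "a - b" scale "b - basis_comb e n c" for c]
  by (auto simp: algebra_simps)

lemma reducible_zero: "reducible e n 0"
  unfolding reducible_def
  by (rule exI[of _ "\<lambda>_. 0"]) (simp add: basis_comb_def ext_ideal_zero)

lemma reducible_add:
  assumes "reducible e n a" "reducible e n b"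
  shows "reducible e n (a + b)"
proof -
  obtain c d where "a - basis_comb e n c \<in> ext_ideal scale" "b - basis_comb e n d \<in> ext_ideal scale"
    using assms unfolding reducible_def by blast
  then have "(a - basis_comb e n c) + (b - basis_comb e n d) \<in> ext_ideal scale"
    by (rule ext_ideal_add)
  moreover have "basis_comb e n (\<lambda>l. c l + d l) = basis_comb e n c + basis_comb e n d"
    by (simp add: basis_comb_def single_add sum.distrib)
  ultimately show ?thesis
    unfolding reducible_def by (intro exI[of _ "\<lambda>l. c l + d l"]) (simp add: algebra_simps)
qed

lemma reducible_sum:
  "(\<And>i. i \<in> S \<Longrightarrow> reducible e n (f i)) \<Longrightarrow> reducible e n (sum f S)"
  by (induction S rule: infinite_finite_induct) (simp_all add: reducible_zero reducible_add)

lemma reducible_scalar: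
  assumes "reducible e n a"
  shows "reducible e n (scalar c * a)"
proof -
  obtain d where "a - basis_comb e n d \<in> ext_ideal scale"
    using assms unfolding reducible_def by blast
  then have "scalar c * (a - basis_comb e n d) \<in> ext_ideal scale"
    by (rule ext_ideal_mult_left)
  moreover have "basis_comb e n (\<lambda>l. c * d l) = scalar c * basis_comb e n d"
    by (simp add: basis_comb_def sum_distrib_left scalar_mult_single)
  ultimately show ?thesis
    unfolding reducible_def by (intro exI[of _ "\<lambda>l. c * d l"]) (simp add: algebra_simps)
qed

lemma reducible_basis_word:
  assumes "l \<in> increasing_lists n"
  shows "reducible e n (Poly_Mapping.single (Word (map e l)) c)"
proof -
  have "basis_comb e n (\<lambda>m. if m = l then c else 0) =
      (\<Sum>m\<in>increasing_lists n. if m = l then Poly_Mapping.single (Word (map e l)) c else 0)"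
    unfolding basis_comb_def by (intro sum.cong) auto
  also have "\<dots> = Poly_Mapping.single (Word (map e l)) c"
    using assms finite_increasing_lists by simp
  finally show ?thesis
    unfolding reducible_def by (metis cancel_comm_monoid_add_class.diff_cancel ext_ideal_zero)
qed

text \<open>One step of insertion sort. The coefficient \<open>d\<close> is \<open>\<plusminus>c\<close>, or \<open>0\<close> if \<open>i\<close> already occurs in
  \<open>l\<close>. The bound on \<open>set m\<close> is what lets the induction put the smaller head of the list back
  in front of \<open>m\<close>.\<close>

lemma insert_letter:
  assumes "l \<in> increasing_lists n" "i < n"
  shows "\<exists>m d. m \<in> increasing_lists n \<and> set m \<subseteq> insert i (set l) \<and>
    Poly_Mapping.single (Word (map e (i # l))) c - Poly_Mapping.single (Word (map e m)) d
      \<in> ext_ideal scale"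
  using assms
proof (induction l)
  case Nil
  then show ?case
    by (intro exI[of _ "[i]"] exI[of _ c]) (auto simp: increasing_lists_def ext_ideal_zero)
next
  case (Cons j l)
  let ?w = "\<lambda>l c. Poly_Mapping.single (Word (map e l)) c"
  have l: "l \<in> increasing_lists n" and jl: "\<forall>k\<in>set l. j < k" and j: "j < n"
    using Cons.prems by (auto simp: increasing_lists_def)
  have w: "?w (k # l) c = letter (e k) * ?w l c" for k l c
    by (simp add: letter_mult_word)
  consider "i < j" | "i = j" | "j < i" by linarith
  then show ?case
  proof cases
    case 1
    then show ?thesis using Cons.prems jl
      by (intro exI[of _ "i # j # l"] exI[of _ c])
        (auto simp: increasing_lists_def ext_ideal_zero)
  next
    case 2
    have "letter (e i) * letter (e i) \<in> ext_ideal scale"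
      by (rule ext_ideal_relation) (auto simp: ext_relations_def)
    then have "letter (e i) * letter (e i) * ?w l c \<in> ext_ideal scale"
      by (rule ext_ideal_mult_right)
    then have "?w (i # j # l) c \<in> ext_ideal scale"
      unfolding w 2 by (simp add: mult.assoc)
    then show ?thesis
      by (intro exI[of _ "[]"] exI[of _ 0]) (auto simp: increasing_lists_def)
  next
    case 3
    obtain m d where m: "m \<in> increasing_lists n" "set m \<subseteq> insert i (set l)"
      and d: "?w (i # l) c - ?w m d \<in> ext_ideal scale"
      using Cons.IH[OF l \<open>i < n\<close>] by blast
    have "(letter (e i) * letter (e j) + letter (e j) * letter (e i)) * ?w l c -
        letter (e j) * (?w (i # l) c - ?w m d) \<in> ext_ideal scale"
      by (intro ext_ideal_diff ext_ideal_mult_right[OF letters_anticommute]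
          ext_ideal_mult_left[OF d])
    moreover have "(letter (e i) * letter (e j) + letter (e j) * letter (e i)) * ?w l c -
        letter (e j) * (?w (i # l) c - ?w m d) = ?w (i # j # l) c - ?w (j # m) (- d)"
      unfolding w by (simp add: algebra_simps single_uminus)
    moreover have "j # m \<in> increasing_lists n" "set (j # m) \<subseteq> insert i (set (j # l))"
      using m jl j 3 by (auto simp: increasing_lists_def)
    ultimately show ?thesis by metis
  qed
qed

lemma reducible_basis_letter:
  assumes "reducible e n a" "i < n"
  shows "reducible e n (letter (e i) * a)"
proof -
  obtain c where "a - basis_comb e n c \<in> ext_ideal scale"
    using assms unfolding reducible_def by blast
  then have "letter (e i) * (a - basis_comb e n c) \<in> ext_ideal scale"
    by (rule ext_ideal_mult_left)
  then have cong: "letter (e i) * a -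
      (\<Sum>l\<in>increasing_lists n. Poly_Mapping.single (Word (map e (i # l))) (c l)) \<in> ext_ideal scale"
    by (simp add: basis_comb_def right_diff_distrib sum_distrib_left letter_mult_word)
  have red: "reducible e n (Poly_Mapping.single (Word (map e (i # l))) (c l))"
    if "l \<in> increasing_lists n" for l
    using insert_letter[OF that \<open>i < n\<close>] reducible_basis_word reducible_cong by metis
  show ?thesis by (rule reducible_cong[OF cong reducible_sum[OF red]])
qed

text \<open>The letters of \<open>0\<close>, of a sum and of a multiple are tied to the vector space structure
  only by the defining relations, so the induction over the span has to invoke these; that
  the letter of \<open>0\<close> lies in the ideal is the relation for the multiple by \<open>0\<close>.\<close>

lemma reducible_letter:
  assumes "reducible e n a" "x \<in> span (e ` {..<n})"
  shows "reducible e n (letter x * a)"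
  using assms(2)
proof (induction rule: span_induct_alt)
  case base
  have "letter (scale 0 0) - scalar 0 * letter 0 \<in> ext_ideal scale"
    by (rule ext_ideal_relation) (unfold ext_relations_def, blast)
  then have "letter 0 \<in> ext_ideal scale" by (simp add: scalar_def)
  then have "letter 0 * a - 0 \<in> ext_ideal scale" by (simp add: ext_ideal_mult_right)
  then show ?case by (rule reducible_cong) (rule reducible_zero)
next
  case (step c x y)
  have "letter (scale c x + y) - letter (scale c x) - letter y \<in> ext_ideal scale"
    "letter (scale c x) - scalar c * letter x \<in> ext_ideal scale"
    by (rule ext_ideal_relation, unfold ext_relations_def, blast)+
  then have "(letter (scale c x + y) - letter (scale c x) - letter y) * a +
      (letter (scale c x) - scalar c * letter x) * a \<in> ext_ideal scale"
    by (intro ext_ideal_add ext_ideal_mult_right)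
  then have "letter (scale c x + y) * a - (scalar c * (letter x * a) + letter y * a)
      \<in> ext_ideal scale"
    by (simp add: algebra_simps)
  moreover have "reducible e n (letter x * a)"
    using step assms(1) reducible_basis_letter by blast
  ultimately show ?case
    using step reducible_cong reducible_add reducible_scalar by metis
qed

lemma basis_words_span:
  assumes "span (e ` {..<n}) = UNIV"
  shows "reducible e n a"
proof (induction a rule: free_alg_induct)
  case (single u c)
  obtain xs where u: "u = Word xs" by (cases u)
  have "reducible e n (Poly_Mapping.single (Word xs) c)"
  proof (induction xs)
    case Nil
    show ?case using reducible_basis_word[of "[]" n e c] by (simp add: increasing_lists_def)
  next
    case (Cons x xs)
    then show ?case using reducible_letter[of e n _ x] assms by (simp flip: letter_mult_word)
  qed
  then show ?case using u by simp
qed (auto intro: reducible_zero reducible_add)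

lemma basis_words_orthonormal:
  assumes "orthonormal e n" and l: "l \<in> increasing_lists n" and m: "m \<in> increasing_lists n"
  shows "word_form ip (Word (map e l)) (Word (map e m)) = of_bool (l = m)"
proof -
  let ?G = "gram_mat ip (map e l) (map e m)"
  have G: "?G $$ (i, j) = of_bool (l ! i = m ! j)" if "i < length l" "j < length m" for i j
  proof -
    have "l ! i < n" "m ! j < n"
      using l m that by (auto simp: increasing_lists_def dest!: nth_mem)
    then show ?thesis using assms(1) that by (simp add: gram_mat_def orthonormal_def)
  qed
  have dist: "distinct l" "distinct m"
    using l m by (auto simp: increasing_lists_def strict_sorted_iff)
  consider "length l \<noteq> length m" | "l = m" | "length l = length m" "l \<noteq> m" by blast
  then show ?thesis
  proof cases
    case 2
    have "?G = 1\<^sub>m (length l)"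
    proof (rule eq_matI)
      fix i j assume "i < dim_row (1\<^sub>m (length l) :: 'k mat)" "j < dim_col (1\<^sub>m (length l) :: 'k mat)"
      then show "?G $$ (i, j) = 1\<^sub>m (length l) $$ (i, j)"
        using G[of i j] 2 dist by (auto simp: nth_eq_iff_index_eq)
    qed (auto simp: 2 gram_mat_def)
    then show ?thesis using 2 by (simp add: word_form_def)
  next
    case 3
    \<comment> \<open>An index of \<open>l\<close> that is missing in \<open>m\<close> gives a zero row.\<close>
    have "\<not> set l \<subseteq> set m"
    proof
      assume "set l \<subseteq> set m"
      moreover have "card (set l) = card (set m)" using dist 3 by (simp add: distinct_card)
      ultimately have "set l = set m" by (simp add: card_subset_eq)
      then show False
        using strict_sorted_equal[of l m] l m 3 by (auto simp: increasing_lists_def)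
    qed
    then obtain k where k: "k < length l" "l ! k \<notin> set m" by (metis in_set_conv_nth subsetI)
    have "?G \<in> carrier_mat (length l) (length l)" using 3 by (simp add: gram_mat_def)
    from laplace_expansion_row[OF this k(1)]
    have "det ?G = (\<Sum>j<length l. ?G $$ (k, j) * cofactor ?G k j)" .
    also have "\<dots> = 0"
      by (rule sum.neutral) (use G[OF k(1)] k 3 in \<open>auto\<close>)
    finally show ?thesis using 3 by (simp add: word_form_def)
  qed (auto simp: word_form_def)
qed

lemma free_form_basis_comb_right:
  assumes "orthonormal e n" "l \<in> increasing_lists n"
  shows "free_form ip (Poly_Mapping.single (Word (map e l)) b) (basis_comb e n c) = conjugate b * c l"
proof -
  have "free_form ip (Poly_Mapping.single (Word (map e l)) b) (basis_comb e n c) =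
      (\<Sum>m\<in>increasing_lists n. if m = l then conjugate b * c m else 0)"
    unfolding basis_comb_def free_form_sum_right
    by (intro sum.cong) (use assms in \<open>auto simp: free_form_single basis_words_orthonormal\<close>)
  then show ?thesis using assms finite_increasing_lists by simp
qed

lemma free_form_ideal_right: "b \<in> ext_ideal scale \<Longrightarrow> free_form ip a b = 0"
  using ext_ideal_orthogonal[of b a] free_form_conjugate[of a b] by simp

lemma free_form_cong_right:
  "b - b' \<in> ext_ideal scale \<Longrightarrow> free_form ip a b = free_form ip a b'"
  using free_form_ideal_right[of "b - b'" a] free_form_add_right[of ip a "b - b'" b'] by simp

text \<open>In coordinates with respect to an orthonormal basis \<open>\<langle>a, a\<rangle>\<close> is the sum of the
  \<open>\<bar>c l\<bar>\<^sup>2\<close>.\<close>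

lemma free_form_positive: "\<exists>r\<ge>0. free_form ip a a = of_real r"
proof -
  obtain e n where e: "orthonormal e n" "span (e ` {..<n}) = UNIV"
    using orthonormal_basis_exists by blast
  obtain c where c: "a - basis_comb e n c \<in> ext_ideal scale"
    using basis_words_span[OF e(2)] unfolding reducible_def by blast
  have "free_form ip a a = free_form ip (basis_comb e n c) (basis_comb e n c)"
    using free_form_cong_right[OF c] free_form_conjugate by metis
  also have "\<dots> = (\<Sum>l\<in>increasing_lists n. conjugate (c l) * c l)"
    by (subst (1) basis_comb_def) (simp add: free_form_sum_left free_form_basis_comb_right[OF e(1)])
  also have "\<dots> = of_real (\<Sum>l\<in>increasing_lists n. (norm (c l))\<^sup>2)"
    by (simp add: conjugate_mult_self scaleR_conv_of_real)
  finally show ?thesis by (meson sum_nonneg zero_le_power2)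
qed

lemma free_form_nondegenerate:
  assumes "\<And>b. free_form ip b a = 0"
  shows "a \<in> ext_ideal scale"
proof -
  obtain e n where e: "orthonormal e n" "span (e ` {..<n}) = UNIV"
    using orthonormal_basis_exists by blast
  obtain c where c: "a - basis_comb e n c \<in> ext_ideal scale"
    using basis_words_span[OF e(2)] unfolding reducible_def by blast
  have "c l = 0" if l: "l \<in> increasing_lists n" for l
    using free_form_basis_comb_right[OF e(1) l, of 1 c]
      free_form_cong_right[OF c] assms by (simp add: conjugate_one)
  then have "basis_comb e n c = 0" by (simp add: basis_comb_def)
  with c show ?thesis by simp
qed


section \<open>The contraction as an iterated Laplace expansion\<close>

text \<open>Contraction by one vector is the antiderivation
  \<open>v \<lrcorner> (w\<^sub>0 \<and> \<dots> \<and> w\<^sub>k) = \<Sum>\<^sub>j (-1)\<^sup>j \<langle>v, w\<^sub>j\<rangle> w\<^sub>0 \<and> \<dots> \<and> w\<^sub>j\<^sub>-\<^sub>1 \<and> w\<^sub>j\<^sub>+\<^sub>1 \<and> \<dots> \<and> w\<^sub>k\<close>, and contraction by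
  \<open>v \<and> A\<close> is contraction by \<open>v\<close> followed by contraction by \<open>A\<close>, since the adjoint of a
  composition reverses the order.\<close>

fun contract :: "'v list \<Rightarrow> 'v list \<Rightarrow> ('v, 'k) free_alg" where
  "contract [] ws = Poly_Mapping.single (Word ws) 1"
| "contract (v # vs) ws = (\<Sum>j<length ws.
     scalar ((- 1) ^ j * ip v (ws ! j)) * contract vs (take j ws @ drop (Suc j) ws))"

text \<open>Laplace expansion along the first row. If the two words differ in length then both sides
  vanish.\<close>

lemma word_form_Cons:
  "word_form ip (Word (v # xs)) (Word ws) = (\<Sum>j<length ws.
     (- 1) ^ j * ip v (ws ! j) * word_form ip (Word xs) (Word (take j ws @ drop (Suc j) ws)))"
proof (cases "length ws = Suc (length xs)")
  case True
  let ?G = "gram_mat ip (v # xs) ws"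
  have G: "?G \<in> carrier_mat (length ws) (length ws)"
    using True by (simp add: gram_mat_def)
  have del: "mat_delete ?G 0 j = gram_mat ip xs (take j ws @ drop (Suc j) ws)"
    if "j < length ws" for j
    by (rule eq_matI) (use that True in \<open>auto simp: mat_delete_def gram_mat_def nth_append\<close>)
  have "det ?G = (\<Sum>j<length ws. ?G $$ (0, j) * cofactor ?G 0 j)"
    by (rule laplace_expansion_row[OF G]) (use True in simp)
  also have "\<dots> = (\<Sum>j<length ws.
     (- 1) ^ j * ip v (ws ! j) * word_form ip (Word xs) (Word (take j ws @ drop (Suc j) ws)))"
  proof (intro sum.cong refl)
    fix j assume j: "j \<in> {..<length ws}"
    then have "?G $$ (0, j) = ip v (ws ! j)" by (simp add: gram_mat_def)
    then show "?G $$ (0, j) * cofactor ?G 0 j =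
      (- 1) ^ j * ip v (ws ! j) * word_form ip (Word xs) (Word (take j ws @ drop (Suc j) ws))"
      using j True del[of j] by (simp add: cofactor_def word_form_def min_def)
  qed
  finally show ?thesis using True by (simp add: word_form_def)
next
  case False
  then have "length xs \<noteq> length (take j ws @ drop (Suc j) ws)" if "j < length ws" for j
    using that by (simp add: min_def)
  then have "word_form ip (Word xs) (Word (take j ws @ drop (Suc j) ws)) = 0"
    if "j < length ws" for j
    using that by (simp add: word_form_def)
  then show ?thesis using False by (simp add: word_form_def)
qed

text \<open>Each vector of \<open>vs\<close> accounts for one Laplace expansion. The second arguments are pure
  words, but \<open>b\<close> is arbitrary, as the definition of the left contraction tests against all
  elements.\<close>

lemma contract_adjoint:
  "free_form ip b (contract vs ws) =
    free_form ip (Poly_Mapping.single (Word vs) 1 * b) (Poly_Mapping.single (Word ws) 1)"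
proof (induction b rule: free_alg_induct)
  case (single u c)
  obtain xs where [simp]: "u = Word xs" by (cases u)
  have "free_form ip (Poly_Mapping.single (Word xs) c) (contract vs ws) =
      conjugate c * word_form ip (Word (vs @ xs)) (Word ws)"
  proof (induction vs arbitrary: ws)
    case Nil
    show ?case by (simp add: free_form_single)
  next
    case (Cons v vs)
    show ?case
      by (simp add: free_form_sum_right free_form_scalar_right Cons.IH word_form_Cons
          sum_distrib_left algebra_simps)
  qed
  then show ?case by (simp add: mult_single free_form_single)
qed (simp_all add: free_form_add_left distrib_left)

text \<open>Adjointness says that the class of \<open>contract vs ws\<close> has the defining property of the left
  contraction; that nothing else has it is nondegeneracy of the inner product.\<close>

lemma left_contraction_blade:
  "left_contraction scale ip (blade scale vs) (blade scale ws) = ext_class scale (contract vs ws)"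
  unfolding left_contraction_def
proof (rule the_equality)
  show "ext_class scale (contract vs ws) \<in> carrier (ext_alg scale) \<and>
      (\<forall>L\<in>carrier (ext_alg scale). ext_inner ip L (ext_class scale (contract vs ws)) =
        ext_inner ip (blade scale vs \<otimes>\<^bsub>ext_alg scale\<^esub> L) (blade scale ws))"
    by (auto simp: carrier_ext_alg blade_eq ext_class_mult ext_inner_class contract_adjoint)
next
  fix K
  assume K: "K \<in> carrier (ext_alg scale) \<and> (\<forall>L\<in>carrier (ext_alg scale).
      ext_inner ip L K = ext_inner ip (blade scale vs \<otimes>\<^bsub>ext_alg scale\<^esub> L) (blade scale ws))"
  then obtain a where a: "K = ext_class scale a" by (auto simp: carrier_ext_alg)
  have "free_form ip b a = free_form ip b (contract vs ws)" for b
    using K unfolding a carrier_ext_alg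
    by (auto simp: blade_eq ext_class_mult ext_inner_class contract_adjoint)
  then have "free_form ip b (a - contract vs ws) = 0" for b
    using free_form_add_right[of ip b "a - contract vs ws" "contract vs ws"] by simp
  then show "K = ext_class scale (contract vs ws)"
    unfolding a by (intro ext_class_eqI free_form_nondegenerate)
qed


section \<open>Inner products of contractions\<close>

lemma sum_lessThan_add:
  fixes f :: "nat \<Rightarrow> 'k"
  shows "sum f {..<m + n} = sum f {..<m} + (\<Sum>j<n. f (m + j))"
  by (induction n) (simp_all add: add.assoc)

text \<open>The \<open>us\<close> label the top rows and the \<open>vs\<close> the left columns. Keeping the two border lists and
  the two Gram lists apart makes the family closed under deleting a row of \<open>ws\<close> together with
  a column of \<open>vs\<close>.\<close>

definition bordered_gram :: "'v list \<Rightarrow> 'v list \<Rightarrow> 'v list \<Rightarrow> 'v list \<Rightarrow> 'k mat" where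
  "bordered_gram us vs ws ws' = four_block_mat
     (0\<^sub>m (length us) (length vs)) (gram_mat ip us ws') (gram_mat ip ws vs) (gram_mat ip ws ws')"

lemma bordered_gram_mat:
  "bordered_gram us vs ws ws' = mat (length us + length ws) (length vs + length ws')
    (\<lambda>(i, j). if i < length us \<and> j < length vs then 0 else ip ((us @ ws) ! i) ((vs @ ws') ! j))"
  by (rule eq_matI) (auto simp: bordered_gram_def gram_mat_def nth_append)

lemma bordered_gram_delete:
  assumes "j < length ws"
  shows "mat_delete (bordered_gram us (v # vs) ws ws') (length us + j) 0 =
    bordered_gram us vs (take j ws @ drop (Suc j) ws) ws'"
  by (rule eq_matI)
    (use assms in \<open>auto simp: bordered_gram_mat mat_delete_def nth_append min_def Suc_diff_le\<close>)

text \<open>Induction over \<open>vs\<close>, expanding along the column of its first vector \<open>v\<close>. The entry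
  \<open>\<langle>w\<^sub>j, v\<rangle>\<close> stands in row \<open>length us + j\<close>, which is why each vector of \<open>vs\<close> costs a sign
  \<open>(-1) ^ length us\<close> beyond the sign \<open>(-1) ^ j\<close> of the contraction. The hypothesis says that
  the matrix is square and that the two contractions have the same degree, in a form without
  subtraction; it covers the case that \<open>vs\<close> is longer than \<open>ws\<close>, where both sides are zero.\<close>

lemma free_form_contract:
  assumes "length us + length ws = length vs + length ws'"
  shows "free_form ip (contract vs ws) (contract us ws') =
    (- 1) ^ (length vs * length us) * det (bordered_gram us vs ws ws')"
  using assms
proof (induction vs arbitrary: ws)
  case Nil
  have "bordered_gram us [] ws ws' = gram_mat ip (us @ ws) ws'"
    by (rule eq_matI) (auto simp: bordered_gram_mat gram_mat_def)
  then show ?case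
    using Nil by (simp add: contract_adjoint mult_single free_form_single conjugate_one word_form_def)
next
  case (Cons v vs)
  let ?p = "length us" and ?M = "bordered_gram us (v # vs) ws ws'"
  let ?N = "\<lambda>j. bordered_gram us vs (take j ws @ drop (Suc j) ws) ws'"
  have M: "?M \<in> carrier_mat (?p + length ws) (?p + length ws)"
    using Cons.prems by (simp add: bordered_gram_mat)
  have "det ?M = (\<Sum>i<?p + length ws. ?M $$ (i, 0) * cofactor ?M i 0)"
    by (rule laplace_expansion_column[OF M]) (use Cons.prems in simp)
  also have "\<dots> = (\<Sum>i<?p. ?M $$ (i, 0) * cofactor ?M i 0) +
      (\<Sum>j<length ws. ?M $$ (?p + j, 0) * cofactor ?M (?p + j) 0)"
    by (rule sum_lessThan_add)
  also have "(\<Sum>i<?p. ?M $$ (i, 0) * cofactor ?M i 0) = 0"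
    by (rule sum.neutral) (simp add: bordered_gram_mat)
  also have "(\<Sum>j<length ws. ?M $$ (?p + j, 0) * cofactor ?M (?p + j) 0) =
      (\<Sum>j<length ws. (- 1) ^ (?p + j) * ip (ws ! j) v * det (?N j))"
    by (intro sum.cong refl)
      (simp add: cofactor_def bordered_gram_delete, simp add: bordered_gram_mat)
  finally have det: "det ?M = (- 1) ^ ?p * (\<Sum>j<length ws. (- 1) ^ j * ip (ws ! j) v * det (?N j))"
    by (simp add: power_add sum_distrib_left mult.assoc)
  have "free_form ip (contract (v # vs) ws) (contract us ws') =
      (\<Sum>j<length ws. (- 1) ^ j * ip (ws ! j) v *
        free_form ip (contract vs (take j ws @ drop (Suc j) ws)) (contract us ws'))"
    by (simp add: free_form_sum_left free_form_scalar_left conjugate_dist_mul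
        conjugate_minus_one_power flip: ip_conjugate)
  also have "\<dots> = (\<Sum>j<length ws. (- 1) ^ j * ip (ws ! j) v *
        ((- 1) ^ (length vs * ?p) * det (?N j)))"
    by (intro sum.cong refl) (use Cons.prems in \<open>simp add: Cons.IH min_def\<close>)
  also have "\<dots> = (- 1) ^ (length vs * ?p) * (\<Sum>j<length ws. (- 1) ^ j * ip (ws ! j) v * det (?N j))"
    by (simp add: sum_distrib_left algebra_simps)
  also have "\<dots> = (- 1) ^ (length (v # vs) * ?p) * det ?M"
    unfolding det by (simp add: power_add algebra_simps flip: power_mult_distrib)
  finally show ?case .
qed

lemma mat_adjoint_gram: "mat_adjoint (gram_mat ip vs ws) = gram_mat ip ws vs"
  by (rule eq_matI) (auto simp: mat_adjoint_def mat_of_rows_def gram_mat_def ip_conjugate[symmetric])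

lemma norm_left_contraction_blade:
  "ext_norm ip (left_contraction scale ip (blade scale vs) (blade scale ws)) =
    sqrt (norm (det (bordered_gram vs vs ws ws)))"
proof -
  let ?K = "contract vs ws"
  obtain r where r: "r \<ge> 0" "free_form ip ?K ?K = of_real r"
    using free_form_positive by blast
  have "norm (det (bordered_gram vs vs ws ws)) = norm (free_form ip ?K ?K)"
    by (simp add: free_form_contract norm_mult norm_power)
  with r show ?thesis
    by (simp add: left_contraction_blade ext_norm_def ext_inner_class real_part_of_real)
qed

end

theorem proposition3p42:
  fixes scale :: "'k::rc_scalar \<Rightarrow> 'v::ab_group_add \<Rightarrow> 'v"
    and ip :: "'v \<Rightarrow> 'v \<Rightarrow> 'k"
    and vs ws :: "'v list"
    and p q :: nat
  assumes "fin_inner_space scale ip"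
    and "length vs = p" and "length ws = q"
  shows "ext_norm ip (left_contraction scale ip (blade scale vs) (blade scale ws)) =
    sqrt (norm (det (four_block_mat
      (0\<^sub>m p p) (gram_mat ip vs ws)
      (mat_adjoint (gram_mat ip vs ws)) (gram_mat ip ws ws))))"
proof -
  interpret fin_inner_space scale ip by fact
  show ?thesis
    using norm_left_contraction_blade[of vs ws] assms(2,3)
    by (simp add: bordered_gram_def mat_adjoint_gram)
qed

end
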